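(* Let $\mathbf{K}$ be a field of arbitrary characteristic, and let $V_1,V_2\in\mathbf{K}[x,y]$ be coprime, $y$-primitive polynomials with $0<\deg_y V_2\le \deg_y V_1$. Let $n\ge 1$, let $V_3,\dots,V_{n+1}\in\mathbf{K}[x,y]$ be $y$-primitive polynomials with $0<\deg_y V_{n+1}<\dots<\deg_y V_3<\deg_y V_2$, put $V_{n+2}=1$, and let $Q_1,\dots,Q_n\in\mathbf{K}[x,y]$ and non-zero $u_1,\dots,u_n,v_1,\dots,v_n\in\mathbf{K}[x]$ be such that $$u_iV_i=Q_iV_{i+1}+v_iV_{i+2}\qquad\text{for } i=1,\dots,n.$$ Define $d_1=\gcd(u_1,v_1)$, $w_1=\frac{u_1}{d_1}$, and, for $i\in\{2,\dots,n\}$, $d_i=\gcd(w_{i-1}u_i,v_i)$, $w_i=\frac{w_{i-1}u_i}{d_i}$ (all in $\mathbf{K}[x]$). Then for every $P\in\mathbf{K}^2$, $$i_P(V_1,V_2)=\sum_{i=1}^n i_P\left(V_{i+1},\frac{v_i}{d_i}\right).$$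
   Context: For $W\in\mathbf{K}[x,y]$, $\deg_y W$ denotes the degree of $W$ with respect to $y$. A non-zero polynomial $W\in\mathbf{K}[x,y]$ is called $y$-primitive if it is primitive as an element of $\mathbf{K}[x][y]$, i.e. the greatest common divisor in $\mathbf{K}[x]$ of its non-zero coefficients (which are polynomials in $x$) is $1$. Polynomials in $\mathbf{K}[x]$ are regarded as elements of $\mathbf{K}[x,y]$. The data $V_3,\dots,V_{n+1},Q_i,u_i,v_i$ are those produced by the Euclidean algorithm (pseudo-division with respect to $y$) on input $(V_1,V_2)$, and $n$ is called its number of steps; when $n=1$ the list $V_3,\dots,V_{n+1}$ is empty and the single relation is $u_1V_1=Q_1V_2+v_1$. Greatest common divisors in $\mathbf{K}[x]$ are defined up to a non-zero constant; any choice may be made. Intersection multiplicity: for $P\in\mathbf{K}^2$ let $\mathbf{K}[x,y]_P=\left\{\frac{R}{S}: R,S\in\mathbf{K}[x,y],\ S(P)\ne 0\right\}$ be the local ring of rational functions regular at $P$. For $V,W\in\mathbf{K}[x,y]$ let $(V,W)_P$ be the ideal generated by $V$ and $W$ in $\mathbf{K}[x,y]_P$. Then $i_P(V,W)$ is the dimension of the $\mathbf{K}$-vector space $\mathbf{K}[x,y]_P/(V,W)_P$. The field $\mathbf{K}$ is not assumed algebraically closed. *)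

theory Defs
  imports
    "Jordan_Normal_Form.VS_Connect"
    "HOL-Algebra.QuotRing"
    "HOL-Computational_Algebra.Polynomial_Factorial"
    "HOL-Library.Extended_Nat"
begin

text \<open>
  The ring \<open>K[x,y]\<close> is represented as \<open>K[x][y]\<close>, i.e. by the type \<^typ>\<open>'a poly poly\<close>: the
  coefficients are polynomials in \<open>x\<close>, \<^const>\<open>Polynomial.degree\<close> is the degree with respect
  to \<open>y\<close>, and \<open>v \<in> K[x]\<close> is regarded as the element \<open>[:v:]\<close> of \<open>K[x,y]\<close>.
\<close>

text \<open>
  The type class \<^class>\<open>field\<close> fixes no gcd on \<^typ>\<open>'a poly\<close>. Greatest common divisors are
  therefore specified by their defining property, which leaves the choice of the constant
  factor open.
\<close>

definition is_gcd :: "'b::comm_semiring_1 set \<Rightarrow> 'b \<Rightarrow> bool" where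
  "is_gcd A d \<longleftrightarrow> (\<forall>a\<in>A. d dvd a) \<and> (\<forall>c. (\<forall>a\<in>A. c dvd a) \<longrightarrow> c dvd d)"

definition y_primitive :: "'a::field poly poly \<Rightarrow> bool" where
  "y_primitive W \<longleftrightarrow> W \<noteq> 0 \<and> is_gcd (set (coeffs W) - {0}) 1"

definition eval_at :: "'a::field poly poly \<Rightarrow> 'a \<times> 'a \<Rightarrow> 'a" where
  "eval_at S P = poly (poly S [:snd P:]) (fst P)"

definition local_ring :: "'a::field \<times> 'a \<Rightarrow> 'a poly poly fract ring" where
  "local_ring P =
    \<lparr>carrier = {Fract R S | R S. eval_at S P \<noteq> 0},
     monoid.mult = (*), one = 1, ring.zero = 0, add = (+)\<rparr>"

definition intersection_ideal ::
  "'a::field \<times> 'a \<Rightarrow> 'a poly poly \<Rightarrow> 'a poly poly \<Rightarrow> 'a poly poly fract set" where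
  "intersection_ideal P V W =
    Idl\<^bsub>local_ring P\<^esub> {to_fract V, to_fract W}"

text \<open>
  The quotient of the local ring as a module over the constants: \<open>c \<in> K\<close> acts as
  multiplication by the coset of \<open>c\<close>.
\<close>

definition quotient_space ::
  "'a::field \<times> 'a \<Rightarrow> 'a poly poly \<Rightarrow> 'a poly poly
    \<Rightarrow> ('a, 'a poly poly fract set) module" where
  "quotient_space P V W =
    (let R = local_ring P; I = intersection_ideal P V W; Q = R Quot I in
      \<lparr>carrier = carrier Q, monoid.mult = monoid.mult Q, one = one Q,
       ring.zero = ring.zero Q, add = add Q,
       smult = (\<lambda>c X. (I +>\<^bsub>R\<^esub> to_fract [:[:c:]:]) \<otimes>\<^bsub>Q\<^esub> X)\<rparr>)"

lemma eval_at_simps [simp]: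
  "eval_at (A + B) P = eval_at A P + eval_at B P"
  "eval_at (A * B) P = eval_at A P * eval_at B P"
  "eval_at 1 P = 1" "eval_at 0 P = 0"
  by (simp_all add: eval_at_def)

lemma local_ring_cring: "cring (local_ring (P :: 'a::field \<times> 'a))"
proof -
  let ?C = "carrier (local_ring P)"
  have C: "?C = {Fract R S | R S. eval_at S P \<noteq> 0}"
    by (simp add: local_ring_def)
  have nz: "S \<noteq> 0" if "eval_at S P \<noteq> 0" for S
    using that by auto
  have add: "a + b \<in> ?C" and mult: "a * b \<in> ?C" if ab: "a \<in> ?C" "b \<in> ?C" for a b
  proof -
    from ab obtain R S R' S' where *: "a = Fract R S" "b = Fract R' S'"
      "eval_at S P \<noteq> 0" "eval_at S' P \<noteq> 0"
      unfolding C by blast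
    have "a + b = Fract (R * S' + R' * S) (S * S')"
      using * nz by (simp add: add_fract)
    moreover have "a * b = Fract (R * R') (S * S')"
      using * by simp
    moreover have "eval_at (S * S') P \<noteq> 0"
      using * by simp
    ultimately show "a + b \<in> ?C" "a * b \<in> ?C"
      unfolding C by blast+
  qed
  have neg: "- a \<in> ?C" if "a \<in> ?C" for a
    using that unfolding C by (auto simp: minus_fract) (metis minus_fract)
  have zero: "0 \<in> ?C" and one: "1 \<in> ?C"
    unfolding C Zero_fract_def One_fract_def
    by (rule CollectI, rule exI[of _ 0], rule exI[of _ 1], simp)
      (rule CollectI, rule exI[of _ 1], rule exI[of _ 1], simp)
  have "\<exists>y\<in>?C. y + x = 0" if "x \<in> ?C" for x
    using neg[OF that] by (intro bexI[of _ "- x"]) auto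
  then show ?thesis
    using add mult zero one
    by (intro cringI abelian_groupI comm_monoidI)
      (auto simp: local_ring_def algebra_simps)
qed

lemma to_fract_in_local_ring: "to_fract V \<in> carrier (local_ring P)"
  unfolding local_ring_def to_fract_def partial_object.simps
  by (rule CollectI, rule exI[of _ V], rule exI[of _ 1], simp)

lemma intersection_ideal_ideal: "ideal (intersection_ideal P V W) (local_ring P)"
proof -
  interpret cring "local_ring P" by (rule local_ring_cring)
  show ?thesis
    unfolding intersection_ideal_def
    by (rule genideal_ideal) (simp add: to_fract_in_local_ring)
qed

lemma quotient_space_vectorspace: "vectorspace class_ring (quotient_space P V W)"
proof -
  define R where "R = local_ring P"
  define I where "I = intersection_ideal P V W"
  define Q where "Q = R Quot I"
  define k where "k = (\<lambda>c. I +>\<^bsub>R\<^esub> to_fract [:[:c:]:])"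
  interpret R: cring R unfolding R_def by (rule local_ring_cring)
  interpret I: ideal I R unfolding R_def I_def by (rule intersection_ideal_ideal)
  interpret Q: cring Q unfolding Q_def by (rule I.quotient_is_cring) (rule R.cring_axioms)
  interpret h: ring_hom_ring R Q "(+>\<^bsub>R\<^esub>) I"
    unfolding Q_def by (rule I.rcos_ring_hom_ring)
  have in_R: "to_fract A \<in> carrier R" for A
    unfolding R_def by (rule to_fract_in_local_ring)
  have ops: "a \<oplus>\<^bsub>R\<^esub> b = a + b" "a \<otimes>\<^bsub>R\<^esub> b = a * b" "\<one>\<^bsub>R\<^esub> = 1" for a b
    by (simp_all add: R_def local_ring_def)
  have k_in: "k c \<in> carrier Q" for c
    unfolding k_def by (rule h.hom_closed[OF in_R])
  have k_add: "k (c + e) = k c \<oplus>\<^bsub>Q\<^esub> k e" for c e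
    unfolding k_def using h.hom_add[OF in_R in_R, of "[:[:c:]:]" "[:[:e:]:]"]
    by (simp add: ops flip: to_fract_add)
  have k_mult: "k (c * e) = k c \<otimes>\<^bsub>Q\<^esub> k e" for c e
    unfolding k_def using h.hom_mult[OF in_R in_R, of "[:[:c:]:]" "[:[:e:]:]"]
    by (simp add: ops flip: to_fract_mult)
  have k_one: "k 1 = \<one>\<^bsub>Q\<^esub>"
    unfolding k_def using h.hom_one by (simp add: ops flip: one_pCons)
  have M: "quotient_space P V W =
      \<lparr>carrier = carrier Q, monoid.mult = monoid.mult Q, one = one Q,
       ring.zero = ring.zero Q, add = add Q, smult = (\<lambda>c X. k c \<otimes>\<^bsub>Q\<^esub> X)\<rparr>"
    by (simp add: quotient_space_def Let_def Q_def R_def I_def k_def)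
  have ag: "abelian_group (quotient_space P V W)"
  proof (rule abelian_groupI, unfold M, simp_all only: partial_object.simps ring.simps monoid.simps)
    fix x y z assume "x \<in> carrier Q" "y \<in> carrier Q" "z \<in> carrier Q"
    then show "x \<oplus>\<^bsub>Q\<^esub> y \<oplus>\<^bsub>Q\<^esub> z = x \<oplus>\<^bsub>Q\<^esub> (y \<oplus>\<^bsub>Q\<^esub> z)" by (rule Q.a_assoc)
  next
    fix x y assume "x \<in> carrier Q" "y \<in> carrier Q"
    then show "x \<oplus>\<^bsub>Q\<^esub> y = y \<oplus>\<^bsub>Q\<^esub> x" by (rule Q.a_comm)
  next
    fix x assume "x \<in> carrier Q"
    then show "\<exists>y\<in>carrier Q. y \<oplus>\<^bsub>Q\<^esub> x = \<zero>\<^bsub>Q\<^esub>" using Q.l_neg by blast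
  qed (simp_all)
  have "Module.module class_ring (quotient_space P V W)"
    by (rule Module.moduleI[OF class_cring.cring_axioms ag])
      (auto simp: M k_in k_add k_mult k_one Q.l_distr Q.r_distr Q.m_assoc)
  then show ?thesis
    unfolding vectorspace_def using class_field.field_axioms by simp
qed

text \<open>
  \<^const>\<open>vectorspace.dim\<close> is the least size of a finite generating set, hence meaningful only in the
  finite-dimensional case.
\<close>

definition intersection_mult ::
  "'a::field \<times> 'a \<Rightarrow> 'a poly poly \<Rightarrow> 'a poly poly \<Rightarrow> enat" where
  "intersection_mult P V W =
    (if vectorspace.fin_dim class_ring (quotient_space P V W)
     then enat (vectorspace.dim class_ring (quotient_space P V W)) else \<infinity>)"

end

theory Submission
  imports Defs
begin

text \<open>
  Let \<open>O\<close> be the local ring at \<open>P\<close>. The usual rules \<open>i\<^sub>P(V, A B) = i\<^sub>P(V, A) + i\<^sub>P(V, B)\<close> and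
  \<open>i\<^sub>P(V, W) = i\<^sub>P(V, W + C V)\<close> turn one division step \<open>u V1 = Q V2 + v V3\<close> into
  \<open>i\<^sub>P(V2, u) + i\<^sub>P(V1, V2) = i\<^sub>P(V2, v) + i\<^sub>P(V2, V3)\<close>. The contribution of \<open>u\<close> has to be
  subtracted, and the numbers \<open>d\<^sub>i\<close> and \<open>w\<^sub>i\<close> of the theorem record how these subtractions cancel
  against the factors \<open>v\<close> of later steps. The proof replaces this bookkeeping by a single quantity
  that already incorporates the denominators still to be cancelled, namely the dimension
  \<open>T(w; V, W)\<close> of \<open>O / ((V, W) : w)\<close>, where \<open>(V, W) : w\<close> is the colon ideal of all \<open>f\<close> with
  \<open>w f \<in> (V, W)\<close>.

  For \<open>d = gcd(w u, v)\<close>, \<open>w' = w u / d\<close> and \<open>v' = v / d\<close>, one division step satisfies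
  \<open>T(w; V1, V2) = i\<^sub>P(V2, v') + T(w'; V2, V3)\<close> (\<open>quotient_dim_euclid_step\<close>). Indeed
  \<open>(V1, V2) : w = (V2, v' V3) : w'\<close> by \<open>colon_euclid_step\<close>, and multiplication by \<open>v'\<close> embeds
  \<open>O / ((V2, V3) : w')\<close> into \<open>O / ((V2, v' V3) : w')\<close> with cokernel \<open>O / (V2, v')\<close>, the last
  because \<open>w'\<close> and \<open>v'\<close> are coprime (\<open>quotient_dim_colon_times_const\<close>). Both facts rest on Gauss's
  lemma: a nonzero element of \<open>K[x]\<close> is no zero divisor modulo the \<open>y\<close>-primitive polynomial \<open>V2\<close>
  (\<open>const_cancel_primitive\<close>).

  The recursion starts with \<open>T(1; V\<^sub>1, V\<^sub>2) = i\<^sub>P(V\<^sub>1, V\<^sub>2)\<close>, produces exactly the weights \<open>w\<^sub>i\<close>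
  and the summands \<open>i\<^sub>P(V\<^sub>i\<^sub>+\<^sub>1, v\<^sub>i / d\<^sub>i)\<close>, and ends with \<open>T(w\<^sub>n; V\<^sub>n\<^sub>+\<^sub>1, 1) = 0\<close>. Every step is
  an equation between extended natural numbers without subtraction, so finiteness of the
  multiplicities is never an issue.
\<close>

section \<open>Dimension of a quotient of subspaces\<close>

text \<open>
  The dimension of \<open>A/I\<close>, phrased inside the ambient space by lifting generators of the
  quotient to \<open>A\<close>. The infimum over the empty set is \<open>\<infinity>\<close>, so that infinite dimension needs
  no separate treatment.
\<close>
definition (in vector_space) quotient_dim :: "'b set \<Rightarrow> 'b set \<Rightarrow> enat" where
  "quotient_dim A I = (INF S\<in>{S. finite S \<and> S \<subseteq> A \<and> A \<subseteq> span (S \<union> I)}. enat (card S))"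

context vector_space
begin

lemma quotient_dim_le:
  "finite S \<Longrightarrow> S \<subseteq> A \<Longrightarrow> A \<subseteq> span (S \<union> I) \<Longrightarrow> quotient_dim A I \<le> enat (card S)"
  unfolding quotient_dim_def by (rule INF_lower) simp

lemma quotient_dim_attained:
  assumes "quotient_dim A I = enat k"
  obtains S where "finite S" "S \<subseteq> A" "A \<subseteq> span (S \<union> I)" "card S = k"
proof -
  let ?D = "(\<lambda>S. enat (card S)) ` {S. finite S \<and> S \<subseteq> A \<and> A \<subseteq> span (S \<union> I)}"
  have "?D \<noteq> {}"
    using assms by (auto simp: quotient_dim_def Inf_enat_def split: if_splits)
  then have "Inf ?D \<in> ?D"
    unfolding Inf_enat_def by (auto intro: LeastI)
  then show thesis
    using assms that unfolding quotient_dim_def by fastforce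
qed

lemma quotient_dim_self: "quotient_dim A A = 0"
  using quotient_dim_le[of "{}" A A] by (simp add: span_superset flip: zero_enat_def)

text \<open>
  A spanning set of \<open>B\<close> modulo \<open>I\<close> splits into one of \<open>B\<close> modulo \<open>A\<close> and one of \<open>A \<inter> B\<close>
  modulo \<open>I\<close> without growing. When a generator \<open>s\<close> is added, either \<open>A\<close> meets the larger span
  in nothing new, and \<open>s\<close> serves modulo \<open>A\<close>; or some \<open>a \<in> A\<close> is new, and then \<open>a\<close> serves in
  \<open>A\<close>, while \<open>s\<close> has become redundant modulo \<open>A\<close>.
\<close>
lemma spanning_set_splits:
  assumes "finite S" and A: "subspace A" "I \<subseteq> A"
  shows "\<exists>S1 S2. finite S1 \<and> finite S2 \<and> S1 \<subseteq> S \<and> S2 \<subseteq> A \<and>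
    card S1 + card S2 \<le> card S \<and>
    span (S \<union> I) \<subseteq> span (S1 \<union> A) \<and> A \<inter> span (S \<union> I) \<subseteq> span (S2 \<union> I)"
  using \<open>finite S\<close>
proof (induction S)
  case empty
  show ?case
    using A span_mono[of I A] by (intro exI[of _ "{}"]) auto
next
  case (insert s S)
  then obtain S1 S2 where IH: "finite S1" "finite S2" "S1 \<subseteq> S" "S2 \<subseteq> A"
    "card S1 + card S2 \<le> card S"
    "span (S \<union> I) \<subseteq> span (S1 \<union> A)" "A \<inter> span (S \<union> I) \<subseteq> span (S2 \<union> I)"
    by blast
  let ?B = "span (S \<union> I)" and ?B' = "span (insert s S \<union> I)"
  have B': "x \<in> ?B' \<longleftrightarrow> (\<exists>k. x - k *s s \<in> ?B)" for x
    using span_breakdown_eq[of x s "S \<union> I"] by simp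
  have gens: "S \<union> I \<subseteq> ?B"
    by (rule span_superset)
  show ?case
  proof (cases "A \<inter> ?B' \<subseteq> ?B")
    case True
    have "insert s S \<union> I \<subseteq> span (insert s S1 \<union> A)"
      using gens IH(6) span_mono[of "S1 \<union> A" "insert s S1 \<union> A"]
        span_superset[of "insert s S1 \<union> A"] by blast
    then have "?B' \<subseteq> span (insert s S1 \<union> A)"
      by (rule span_minimal) simp
    moreover have "A \<inter> ?B' \<subseteq> span (S2 \<union> I)"
      using True IH(7) by blast
    moreover have "card (insert s S1) + card S2 \<le> card (insert s S)"
      using insert.hyps IH by (simp add: card_insert_if)
    ultimately show ?thesis
      using IH by (intro exI[of _ "insert s S1"] exI[of _ S2]) auto
  next
    case False
    then obtain a where a: "a \<in> A" "a \<in> ?B'" "a \<notin> ?B"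
      by blast
    then obtain k where k: "a - k *s s \<in> ?B"
      using B' by blast
    with a have "k \<noteq> 0"
      by auto
    have "s = inverse k *s (a - (a - k *s s))"
      using \<open>k \<noteq> 0\<close> by simp
    moreover have "a \<in> span (S1 \<union> A)"
      using a(1) by (intro span_base) simp
    ultimately have "s \<in> span (S1 \<union> A)"
      using k IH(6) by (metis span_diff span_scale subsetD)
    with gens IH(6) have "?B' \<subseteq> span (S1 \<union> A)"
      by (intro span_minimal) auto
    moreover have "A \<inter> ?B' \<subseteq> span (insert a S2 \<union> I)"
    proof
      fix x assume x: "x \<in> A \<inter> ?B'"
      then obtain l where l: "x - l *s s \<in> ?B"
        using B' by blast
      let ?m = "l * inverse k"
      have "x - ?m *s a = (x - l *s s) - ?m *s (a - k *s s)"
        using \<open>k \<noteq> 0\<close> by (simp add: scale_right_diff_distrib)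
      with k l have "x - ?m *s a \<in> ?B"
        by (metis span_diff span_scale)
      moreover have "x - ?m *s a \<in> A"
        using A a x by (simp add: subspace_diff subspace_scale)
      ultimately have "x - ?m *s a \<in> span (S2 \<union> I)"
        using IH(7) by blast
      then show "x \<in> span (insert a S2 \<union> I)"
        using span_breakdown_eq[of x a "S2 \<union> I"] by auto
    qed
    moreover have "card S1 + card (insert a S2) \<le> card (insert s S)"
      using insert.hyps IH by (simp add: card_insert_if)
    ultimately show ?thesis
      using IH a by (intro exI[of _ S1] exI[of _ "insert a S2"]) auto
  qed
qed

text \<open>
  Additivity along \<open>I \<subseteq> A \<subseteq> B\<close>, valid for infinite dimensions too: the upper bound joins
  lifted generators, the lower bound is the splitting above.
\<close>
lemma quotient_dim_add:
  assumes A: "subspace A" "I \<subseteq> A" "A \<subseteq> B" 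
  shows "quotient_dim B I = quotient_dim B A + quotient_dim A I"
proof (rule antisym)
  show "quotient_dim B I \<le> quotient_dim B A + quotient_dim A I"
  proof (cases "quotient_dim B A = \<infinity> \<or> quotient_dim A I = \<infinity>")
    case False
    then obtain k l where kl: "quotient_dim B A = enat k" "quotient_dim A I = enat l"
      by auto
    from kl obtain S T where S: "finite S" "S \<subseteq> B" "B \<subseteq> span (S \<union> A)" "card S = k"
      and T: "finite T" "T \<subseteq> A" "A \<subseteq> span (T \<union> I)" "card T = l"
      by (metis quotient_dim_attained)
    have "S \<union> A \<subseteq> span (S \<union> T \<union> I)"
      using T(3) span_mono[of "T \<union> I" "S \<union> T \<union> I"] span_superset[of "S \<union> T \<union> I"] by blast
    then have "span (S \<union> A) \<subseteq> span (S \<union> T \<union> I)"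
      by (rule span_minimal) simp
    with S T A have "quotient_dim B I \<le> enat (card (S \<union> T))"
      by (intro quotient_dim_le) auto
    also have "\<dots> \<le> enat (k + l)"
      using card_Un_le[of S T] S T by simp
    finally show ?thesis
      using kl by simp
  qed auto
  show "quotient_dim B A + quotient_dim A I \<le> quotient_dim B I"
  proof (cases "quotient_dim B I")
    case (enat k)
    then obtain S where S: "finite S" "S \<subseteq> B" "B \<subseteq> span (S \<union> I)" "card S = k"
      by (rule quotient_dim_attained)
    obtain S1 S2 where *: "finite S1" "finite S2" "S1 \<subseteq> S" "S2 \<subseteq> A"
      "card S1 + card S2 \<le> card S"
      "span (S \<union> I) \<subseteq> span (S1 \<union> A)" "A \<inter> span (S \<union> I) \<subseteq> span (S2 \<union> I)"
      using spanning_set_splits[OF S(1) A(1,2)] by blast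
    have "quotient_dim B A \<le> enat (card S1)" "quotient_dim A I \<le> enat (card S2)"
      using * S A by (intro quotient_dim_le; blast)+
    then have "quotient_dim B A + quotient_dim A I \<le> enat (card S1 + card S2)"
      using add_mono by fastforce
    with * S enat show ?thesis
      by (metis enat_ord_simps(1) order_trans)
  qed simp
qed

text \<open>
  A linear map \<open>f\<close> that sends \<open>A\<close> onto \<open>B\<close> modulo \<open>J\<close> induces an isomorphism of
  \<open>A/f\<inverse>(J)\<close> with \<open>B/J\<close>; generators are pushed forward along \<open>f\<close>, or pulled back by
  choosing preimages modulo \<open>J\<close>.
\<close>
lemma quotient_dim_transport:
  assumes f: "module_hom scale scale f"
    and J: "subspace J" and A: "subspace A" and fA: "f ` A \<subseteq> B"
    and surj: "B \<subseteq> span (f ` A \<union> J)"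
  shows "quotient_dim B J = quotient_dim A {a \<in> A. f a \<in> J}"
proof (rule antisym)
  interpret f: module_hom scale scale f by (rule f)
  let ?I = "{a \<in> A. f a \<in> J}"
  show "quotient_dim B J \<le> quotient_dim A ?I"
  proof (cases "quotient_dim A ?I")
    case (enat k)
    then obtain S where S: "finite S" "S \<subseteq> A" "A \<subseteq> span (S \<union> ?I)" "card S = k"
      by (rule quotient_dim_attained)
    have "f ` A \<subseteq> span (f ` (S \<union> ?I))"
      using S(3) f.spans_image by blast
    also have "\<dots> \<subseteq> span (f ` S \<union> J)"
      by (rule span_mono) auto
    finally have "span (f ` A \<union> J) \<subseteq> span (f ` S \<union> J)"
      using span_superset[of "f ` S \<union> J"] by (intro span_minimal) auto
    with surj have "B \<subseteq> span (f ` S \<union> J)"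
      by (rule subset_trans)
    moreover have "f ` S \<subseteq> B"
      using S(2) fA by blast
    ultimately have "quotient_dim B J \<le> enat (card (f ` S))"
      using S(1) by (intro quotient_dim_le) simp_all
    also have "\<dots> \<le> enat k"
      using S card_image_le by auto
    finally show ?thesis
      using enat by simp
  qed simp
  have span_J: "span J = J"
    using J by simp
  show "quotient_dim A ?I \<le> quotient_dim B J"
  proof (cases "quotient_dim B J")
    case (enat k)
    then obtain T where T: "finite T" "T \<subseteq> B" "B \<subseteq> span (T \<union> J)" "card T = k"
      by (rule quotient_dim_attained)
    have "\<exists>a\<in>A. t - f a \<in> J" if "t \<in> T" for t
    proof -
      have "span (f ` A \<union> J) = {x + y |x y. x \<in> f ` A \<and> y \<in> J}"
        using span_J f.subspace_image[OF A] unfolding span_eq_iff[symmetric]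
        by (simp only: span_Un)
      with that T surj obtain a y where "a \<in> A" "y \<in> J" "t = f a + y"
        by blast
      then show ?thesis
        by (intro bexI[of _ a]) auto
    qed
    then obtain g where g: "g t \<in> A" "t - f (g t) \<in> J" if "t \<in> T" for t
      by metis
    have "A \<subseteq> span (g ` T \<union> ?I)"
    proof
      fix a assume a: "a \<in> A"
      have "T \<union> J \<subseteq> span (f ` g ` T \<union> J)"
      proof
        fix t assume "t \<in> T \<union> J"
        then show "t \<in> span (f ` g ` T \<union> J)"
        proof
          assume t: "t \<in> T"
          then have "f (g t) \<in> span (f ` g ` T \<union> J)" "t - f (g t) \<in> span (f ` g ` T \<union> J)"
            using g by (auto intro: span_base)
          then show ?thesis
            by (metis span_add diff_add_cancel)
        qed (auto intro: span_base)
      qed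
      then have "span (T \<union> J) \<subseteq> span (f ` g ` T \<union> J)"
        by (rule span_minimal) simp
      with a fA T have "f a \<in> span (f ` g ` T \<union> J)"
        by blast
      moreover have "span (f ` g ` T \<union> J) = {x + y |x y. x \<in> f ` span (g ` T) \<and> y \<in> J}"
        by (simp only: span_Un span_J f.span_image)
      ultimately obtain b y where b: "b \<in> span (g ` T)" "y \<in> J" "f a = f b + y"
        by blast
      have "b \<in> A"
        using b(1) g(1) span_minimal[OF _ A, of "g ` T"] by blast
      with a b A have "a - b \<in> ?I"
        by (simp add: subspace_diff f.diff)
      then have "a - b \<in> span (g ` T \<union> ?I)"
        by (intro span_base) simp
      moreover have "b \<in> span (g ` T \<union> ?I)"
        using b(1) span_mono[of "g ` T" "g ` T \<union> ?I"] by blast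
      ultimately show "a \<in> span (g ` T \<union> ?I)"
        by (metis span_add diff_add_cancel)
    qed
    then have "quotient_dim A ?I \<le> enat (card (g ` T))"
      using T g by (intro quotient_dim_le) auto
    also have "\<dots> \<le> enat k"
      using T card_image_le by auto
    finally show ?thesis
      using enat by simp
  qed simp
qed

end

section \<open>Univariate polynomials and Gauss's lemma\<close>

text \<open>
  Euclid's algorithm yields some common divisor of the form \<open>r * p + s * q\<close>; it divides the
  greatest common divisor \<open>d\<close>, which is therefore of this form as well.
\<close>
lemma is_gcd_imp_bezout:
  fixes p q d :: "'a::field poly"
  assumes "is_gcd {p, q} d"
  shows "\<exists>r s. d = r * p + s * q"
proof -
  \<comment> \<open>The measure puts \<open>q = 0\<close> below the nonzero constants, which also have degree 0.\<close>
  have "\<exists>g. (\<exists>r s. g = r * p + s * q) \<and> g dvd p \<and> g dvd q" for p q :: "'a poly"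
  proof (induction "if q = 0 then 0 else Suc (degree q)" arbitrary: p q rule: less_induct)
    case less
    show ?case
    proof (cases "q = 0")
      case True
      then show ?thesis
        by (intro exI[of _ p] conjI exI[of _ 1]) auto
    next
      case False
      let ?m = "p mod q"
      have "?m = 0 \<or> degree ?m < degree q"
        using False by (rule degree_mod_less)
      then have "\<exists>g. (\<exists>r s. g = r * q + s * ?m) \<and> g dvd q \<and> g dvd ?m"
        using False by (intro less) auto
      then obtain g r s where g: "g = r * q + s * ?m" "g dvd q" "g dvd ?m"
        by blast
      have "g = s * p + (r - s * (p div q)) * q"
        using g(1) by (simp add: minus_div_mult_eq_mod[symmetric] algebra_simps)
      moreover have "g dvd p"
        using g dvd_mod_imp_dvd by blast
      ultimately show ?thesis
        using g by blast
    qed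
  qed
  then obtain g r s where g: "g = r * p + s * q" "g dvd p" "g dvd q"
    by blast
  from assms g have "g dvd d" 
    by (simp add: is_gcd_def)
  then obtain h where "d = g * h" ..
  with g have "d = (h * r) * p + (h * s) * q"
    by (simp add: algebra_simps)
  then show ?thesis
    by blast
qed

text \<open>A nonconstant divisor of least degree is irreducible.\<close>
lemma exists_irreducible_divisor:
  fixes c :: "'a::field poly"
  assumes "degree c > 0"
  shows "\<exists>p. irreducible p \<and> p dvd c"
proof -
  define D where "D p \<longleftrightarrow> degree p > 0 \<and> p dvd c" for p
  have "D c"
    using assms by (simp add: D_def)
  then obtain p where p: "D p" "\<And>q. D q \<Longrightarrow> degree p \<le> degree q"
    using ex_has_least_nat[of D c degree] by blast
  have "irreducible p"
  proof (rule irreducibleI)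
    show "p \<noteq> 0"
      using p(1) by (auto simp: D_def)
    then show "\<not> p dvd 1"
      using p(1) by (simp add: D_def is_unit_iff_degree)
    fix a b assume ab: "p = a * b"
    with p(1) have nz: "a \<noteq> 0" "b \<noteq> 0"
      by (auto simp: D_def)
    have deg: "degree p = degree a + degree b"
      using ab nz by (simp add: degree_mult_eq)
    have "a dvd c" "b dvd c"
      using p(1) ab by (auto simp: D_def intro: dvd_mult_left dvd_mult_right)
    then have "degree a = 0 \<or> degree b = 0"
      using p(2)[of a] deg unfolding D_def by linarith
    then show "a dvd 1 \<or> b dvd 1"
      using nz by (simp add: is_unit_iff_degree)
  qed
  then show ?thesis
    using p(1) D_def by blast
qed

text \<open>
  Gauss's lemma: an irreducible factor \<open>p\<close> of \<open>c\<close> stays prime in \<open>K[x][y]\<close> and divides no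
  primitive polynomial, hence it divides \<open>A\<close>; cancel it and repeat with \<open>c/p\<close>.
\<close>
lemma const_dvd_primitive_mult:
  fixes V A :: "'a::field poly poly"
  assumes V: "y_primitive V" and "c \<noteq> 0" and "[:c:] dvd A * V"
  shows "[:c:] dvd A"
  using assms(2,3)
proof (induction "degree c" arbitrary: c A rule: less_induct)
  case less
  show ?case
  proof (cases "degree c = 0")
    case True
    then have "c dvd 1"
      using less.prems by (simp add: is_unit_iff_degree)
    then show ?thesis
      by (metis const_poly_dvd_iff dvd_mult_right mult_1 dvd_trans one_dvd)
  next
    case False
    then obtain p where p: "irreducible p" "p dvd c"
      using exists_irreducible_divisor by blast
    then obtain e where e: "c = p * e" by blast
    have prime: "prime_elem [:p:]"
      using p by (intro lift_prime_elem_poly field_poly_irreducible_imp_prime)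
    have "\<not> [:p:] dvd V"
    proof
      assume "[:p:] dvd V"
      then have "p dvd coeff V i" for i
        by (simp add: const_poly_dvd_iff)
      then have "p dvd x" if "x \<in> set (coeffs V)" for x
        using that by (auto simp: coeffs_def split: if_splits)
      then have "p dvd 1"
        using V by (auto simp: y_primitive_def is_gcd_def)
      then show False
        using p by (simp add: irreducible_def)
    qed
    moreover have "[:p:] dvd A * V"
      using less.prems(2) e by (metis const_poly_dvd_const_poly_iff dvd_triv_left dvd_trans)
    ultimately have "[:p:] dvd A"
      using prime prime_elem_dvd_multD by blast
    then obtain B where B: "A = [:p:] * B" by blast
    have "[:p:] \<noteq> 0" "e \<noteq> 0"
      using p less.prems e by auto
    have "[:c:] = [:p:] * [:e:]"
      using e by simp
    then have "[:e:] dvd B * V"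
      using less.prems(2) B \<open>[:p:] \<noteq> 0\<close> by (metis dvd_mult_cancel_left mult.assoc)
    moreover have "degree e < degree c"
    proof -
      have "degree p > 0"
        using p by (metis irreducible_def is_unit_iff_degree neq0_conv)
      then show ?thesis
        using e less.prems by (simp add: degree_mult_eq)
    qed
    ultimately have "[:e:] dvd B"
      using less.hyps \<open>e \<noteq> 0\<close> by blast
    then show ?thesis
      using B \<open>[:c:] = [:p:] * [:e:]\<close> by (simp only: mult_dvd_mono dvd_refl)
  qed
qed

section \<open>The local ring as a vector space\<close>
definition const_scale :: "'a::field \<Rightarrow> 'a poly poly fract \<Rightarrow> 'a poly poly fract" where
  "const_scale c f = to_fract [:[:c:]:] * f"

interpretation fract: vector_space "const_scale :: 'a::field \<Rightarrow> _"
proof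
  fix a b :: 'a and x y :: "'a poly poly fract"
  show "const_scale a (x + y) = const_scale a x + const_scale a y"
    by (simp add: const_scale_def algebra_simps)
  have "[:[:a + b:]:] = [:[:a:]:] + [:[:b:]:]" "[:[:a * b:]:] = [:[:a:]:] * [:[:b:]:]"
    by simp_all
  then show "const_scale (a + b) x = const_scale a x + const_scale b x"
    "const_scale a (const_scale b x) = const_scale (a * b) x"
    unfolding const_scale_def by (simp_all only: to_fract_add to_fract_mult algebra_simps)
  show "const_scale 1 x = x"
    by (simp add: const_scale_def flip: one_pCons)
qed

lemma local_ring_ops [simp]:
  "a \<oplus>\<^bsub>local_ring P\<^esub> b = a + b" "a \<otimes>\<^bsub>local_ring P\<^esub> b = a * b"
  "\<one>\<^bsub>local_ring P\<^esub> = 1" "\<zero>\<^bsub>local_ring P\<^esub> = 0"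
  by (simp_all add: local_ring_def)

lemma local_ring_closed [simp, intro]:
  fixes P :: "'a::field \<times> 'a"
  defines "C \<equiv> carrier (local_ring P)"
  shows "to_fract A \<in> C" "0 \<in> C" "1 \<in> C"
    "a \<in> C \<Longrightarrow> b \<in> C \<Longrightarrow> a + b \<in> C" "a \<in> C \<Longrightarrow> b \<in> C \<Longrightarrow> a * b \<in> C"
    "a \<in> C \<Longrightarrow> - a \<in> C" "a \<in> C \<Longrightarrow> b \<in> C \<Longrightarrow> a - b \<in> C"
proof -
  interpret cring "local_ring P" by (rule local_ring_cring)
  show tf: "to_fract A \<in> C" for A
    unfolding C_def by (rule to_fract_in_local_ring)
  show "0 \<in> C" "1 \<in> C"
    using zero_closed one_closed unfolding C_def by simp_all
  show add: "a + b \<in> C" if "a \<in> C" "b \<in> C" for a b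
    using a_closed that unfolding C_def by simp
  show mult: "a * b \<in> C" if "a \<in> C" "b \<in> C" for a b
    using m_closed that unfolding C_def by simp
  show neg: "- a \<in> C" if "a \<in> C" for a
    using mult[OF tf[of "- 1"] that] by simp
  show "a - b \<in> C" if "a \<in> C" "b \<in> C" for a b
    using add[OF that(1) neg[OF that(2)]] by simp
qed

lemma subspace_local_ring: "fract.subspace (carrier (local_ring P))"
  by (rule fract.subspaceI) (auto simp: const_scale_def)

text \<open>
  The linear combinations of the two generators with coefficients in the local ring form an
  ideal, and every ideal containing the generators contains them.
\<close>
lemma mem_intersection_ideal_iff:
  "x \<in> intersection_ideal P V W \<longleftrightarrow>
    (\<exists>a\<in>carrier (local_ring P). \<exists>b\<in>carrier (local_ring P). x = a * to_fract V + b * to_fract W)"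
proof -
  interpret cring "local_ring P" by (rule local_ring_cring)
  let ?O = "carrier (local_ring P)"
  define J where "J = {a * to_fract V + b * to_fract W |a b. a \<in> ?O \<and> b \<in> ?O}"
  have JI: "a * to_fract V + b * to_fract W \<in> J" if "a \<in> ?O" "b \<in> ?O" for a b
    using that by (auto simp: J_def)
  have mult: "c * x \<in> J" if "c \<in> ?O" "x \<in> J" for c x
  proof -
    from that obtain a b where "a \<in> ?O" "b \<in> ?O" "x = a * to_fract V + b * to_fract W"
      by (auto simp: J_def)
    with that JI[of "c * a" "c * b"] show ?thesis
      by (simp add: algebra_simps)
  qed
  have "ideal J (local_ring P)"
  proof (rule idealI)
    show "ring (local_ring P)" by (rule ring_axioms)
    show "subgroup J (add_monoid (local_ring P))"
    proof
      show "J \<subseteq> carrier (add_monoid (local_ring P))"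
        by (auto simp: J_def)
      show "\<one>\<^bsub>add_monoid (local_ring P)\<^esub> \<in> J"
        using JI[of 0 0] by simp
      fix x assume x: "x \<in> J"
      show "x \<otimes>\<^bsub>add_monoid (local_ring P)\<^esub> y \<in> J" if "y \<in> J" for y
      proof -
        from that x obtain a b c d where "a \<in> ?O" "b \<in> ?O" "x = a * to_fract V + b * to_fract W"
          "c \<in> ?O" "d \<in> ?O" "y = c * to_fract V + d * to_fract W"
          by (auto simp: J_def)
        with JI[of "a + c" "b + d"] show ?thesis
          by (simp add: algebra_simps)
      qed
      have "- x \<in> J"
        using mult[of "- 1" x] x by simp
      moreover have "x \<in> ?O"
        using x by (auto simp: J_def)
      then have "\<ominus>\<^bsub>local_ring P\<^esub> x = - x"
        by (intro minus_equality) auto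
      ultimately show "inv\<^bsub>add_monoid (local_ring P)\<^esub> x \<in> J"
        by (simp add: a_inv_def)
    qed
    show "c \<otimes>\<^bsub>local_ring P\<^esub> x \<in> J" "x \<otimes>\<^bsub>local_ring P\<^esub> c \<in> J"
      if "x \<in> J" "c \<in> ?O" for x c
      using mult[OF that(2,1)] by (simp_all add: mult.commute)
  qed
  moreover have "{to_fract V, to_fract W} \<subseteq> J"
    using JI[of 1 0] JI[of 0 1] by auto
  ultimately have "intersection_ideal P V W \<subseteq> J"
    unfolding intersection_ideal_def by (rule genideal_minimal)
  moreover have "J \<subseteq> intersection_ideal P V W"
  proof
    fix x assume "x \<in> J"
    then obtain a b where ab: "a \<in> ?O" "b \<in> ?O" "x = a * to_fract V + b * to_fract W"
      by (auto simp: J_def)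
    interpret I: ideal "intersection_ideal P V W" "local_ring P"
      by (rule intersection_ideal_ideal)
    have "{to_fract V, to_fract W} \<subseteq> intersection_ideal P V W"
      unfolding intersection_ideal_def by (rule genideal_self) auto
    with ab I.I_l_closed I.a_closed show "x \<in> intersection_ideal P V W"
      by auto
  qed
  ultimately have "intersection_ideal P V W = J"
    by blast
  then show ?thesis
    by (auto simp: J_def)
qed

lemma intersection_ideal_subset: "intersection_ideal P V W \<subseteq> carrier (local_ring P)"
  by (auto simp: mem_intersection_ideal_iff)

lemma intersection_ideal_mult:
  assumes "f \<in> carrier (local_ring P)" "x \<in> intersection_ideal P V W"
  shows "f * x \<in> intersection_ideal P V W"
  using assms ideal.I_l_closed[OF intersection_ideal_ideal] by fastforce

lemma subspace_intersection_ideal: "fract.subspace (intersection_ideal P V W)"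
proof (rule fract.subspaceI)
  have subgroup: "additive_subgroup (intersection_ideal P V W) (local_ring P)"
    using intersection_ideal_ideal by (rule ideal.axioms)
  show "0 \<in> intersection_ideal P V W"
    using additive_subgroup.zero_closed[OF subgroup] by simp
  show "x + y \<in> intersection_ideal P V W"
    if "x \<in> intersection_ideal P V W" "y \<in> intersection_ideal P V W" for x y
    using additive_subgroup.a_closed[OF subgroup that] by simp
qed (simp add: const_scale_def intersection_ideal_mult local_ring_closed)

text \<open>
  This replaces the space of cosets by generators in the local ring itself: a family of cosets
  generates the quotient exactly if its representatives, together with the ideal, span the local
  ring. The two descriptions count the same numbers because a finite set of cosets has a set of
  representatives of equal size.
\<close>
lemma intersection_mult_eq_quotient_dim:
  "intersection_mult P V W =
    fract.quotient_dim (carrier (local_ring P)) (intersection_ideal P V W)"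
proof -
  define R where "R = local_ring P"
  define I where "I = intersection_ideal P V W"
  define M where "M = quotient_space P V W"
  define \<pi> where "\<pi> f = I +>\<^bsub>R\<^esub> f" for f
  let ?O = "carrier R"
  interpret R: cring R unfolding R_def by (rule local_ring_cring)
  interpret I: ideal I R unfolding R_def I_def by (rule intersection_ideal_ideal)
  interpret h: ring_hom_ring R "R Quot I" "(+>\<^bsub>R\<^esub>) I"
    by (rule I.rcos_ring_hom_ring)
  interpret M: vectorspace class_ring M
    unfolding M_def by (rule quotient_space_vectorspace)
  have ops: "a \<oplus>\<^bsub>R\<^esub> b = a + b" "a \<otimes>\<^bsub>R\<^esub> b = a * b" for a b
    by (simp_all add: R_def)
  have closed: "to_fract A \<in> ?O" "0 \<in> ?O" "a \<in> ?O \<Longrightarrow> b \<in> ?O \<Longrightarrow> a + b \<in> ?O"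
    "a \<in> ?O \<Longrightarrow> b \<in> ?O \<Longrightarrow> a * b \<in> ?O" "a \<in> ?O \<Longrightarrow> b \<in> ?O \<Longrightarrow> a - b \<in> ?O"
    for A :: "'a poly poly" and a b
    by (simp_all add: R_def local_ring_closed)
  have subO: "fract.subspace ?O" and subI: "fract.subspace I" and IO: "I \<subseteq> ?O"
    by (simp_all add: R_def I_def subspace_local_ring subspace_intersection_ideal
        intersection_ideal_subset)
  have carrier_M: "carrier M = \<pi> ` ?O"
    by (auto simp: M_def quotient_space_def Let_def FactRing_def A_RCOSETS_def' \<pi>_def R_def I_def)
  have zero_M: "\<zero>\<^bsub>M\<^esub> = \<pi> 0"
    using h.hom_zero
    by (simp add: M_def quotient_space_def Let_def \<pi>_def R_def I_def)
  have add_M: "\<pi> f \<oplus>\<^bsub>M\<^esub> \<pi> g = \<pi> (f + g)" if "f \<in> ?O" "g \<in> ?O" for f g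
    using h.hom_add[OF that] that
    by (simp add: M_def quotient_space_def Let_def \<pi>_def R_def I_def)
  have smult_M: "c \<odot>\<^bsub>M\<^esub> \<pi> f = \<pi> (const_scale c f)" if "f \<in> ?O" for c f
    using h.hom_mult[OF _ that, of "to_fract [:[:c:]:]"] that
    by (simp add: M_def quotient_space_def Let_def \<pi>_def R_def I_def const_scale_def
        to_fract_in_local_ring)
  have \<pi>_eq: "\<pi> f = \<pi> g \<longleftrightarrow> f - g \<in> I" if fg: "f \<in> ?O" "g \<in> ?O" for f g
  proof -
    have "\<ominus>\<^bsub>R\<^esub> g = - g"
      using closed(5)[OF closed(2) fg(2)] fg by (intro R.minus_equality) (auto simp: R_def)
    then show ?thesis
      using R.quotient_eq_iff_same_a_r_cos[OF I.ideal_axioms that]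
      by (simp add: \<pi>_def a_minus_def ops)
  qed
  have gen_set_iff: "M.gen_set (\<pi> ` S) \<longleftrightarrow> ?O \<subseteq> fract.span (S \<union> I)" if S: "S \<subseteq> ?O" for S
  proof -
    have \<pi>S: "\<pi> ` S \<subseteq> carrier M"
      using S carrier_M by auto
    interpret sp: LinearCombinations.submodule class_ring "M.span (\<pi> ` S)" M
      by (rule M.span_is_submodule[OF \<pi>S])
    show ?thesis
    proof
      assume gen: "M.gen_set (\<pi> ` S)"
      have "LinearCombinations.submodule class_ring (\<pi> ` (?O \<inter> fract.span (S \<union> I))) M"
      proof (unfold_locales)
        show "\<pi> ` (?O \<inter> fract.span (S \<union> I)) \<subseteq> carrier M"
          using carrier_M by auto
        show "\<zero>\<^bsub>M\<^esub> \<in> \<pi> ` (?O \<inter> fract.span (S \<union> I))"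
          using zero_M closed(2) fract.span_zero by auto
        fix x y assume "x \<in> \<pi> ` (?O \<inter> fract.span (S \<union> I))" "y \<in> \<pi> ` (?O \<inter> fract.span (S \<union> I))"
        then show "x \<oplus>\<^bsub>M\<^esub> y \<in> \<pi> ` (?O \<inter> fract.span (S \<union> I))"
          by (auto simp: add_M intro!: imageI closed(3) fract.span_add)
      next
        fix c x assume "x \<in> \<pi> ` (?O \<inter> fract.span (S \<union> I))"
        then show "c \<odot>\<^bsub>M\<^esub> x \<in> \<pi> ` (?O \<inter> fract.span (S \<union> I))"
          by (auto simp: smult_M intro!: imageI fract.subspace_scale[OF subO] fract.span_scale)
      qed
      moreover have "\<pi> ` S \<subseteq> \<pi> ` (?O \<inter> fract.span (S \<union> I))"
        using S by (auto intro: fract.span_base)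
      ultimately have "M.span (\<pi> ` S) \<subseteq> \<pi> ` (?O \<inter> fract.span (S \<union> I))"
        by (intro M.span_is_subset)
      with gen have sub: "\<pi> ` ?O \<subseteq> \<pi> ` (?O \<inter> fract.span (S \<union> I))"
        by (simp add: carrier_M)
      show "?O \<subseteq> fract.span (S \<union> I)"
      proof
        fix f assume f: "f \<in> ?O"
        with sub obtain g where g: "g \<in> ?O" "g \<in> fract.span (S \<union> I)" "\<pi> f = \<pi> g"
          by blast
        with f have "f - g \<in> fract.span (S \<union> I)"
          using \<pi>_eq by (auto intro: fract.span_base)
        with g show "f \<in> fract.span (S \<union> I)"
          by (metis diff_add_cancel fract.span_add)
      qed
    next
      assume spans: "?O \<subseteq> fract.span (S \<union> I)"
      let ?N = "{f \<in> ?O. \<pi> f \<in> M.span (\<pi> ` S)}"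
      have "fract.subspace ?N"
      proof (rule fract.subspaceI)
        show "0 \<in> ?N"
          using sp.zero_closed closed(2) by (simp add: zero_M)
        show "x + y \<in> ?N" if "x \<in> ?N" "y \<in> ?N" for x y
          using that sp.m_closed closed(3) by (auto simp flip: add_M)
        show "const_scale c x \<in> ?N" if "x \<in> ?N" for c x
          using that sp.smult_closed[of c "\<pi> x"] fract.subspace_scale[OF subO]
          by (auto simp flip: smult_M)
      qed
      moreover have "S \<union> I \<subseteq> ?N"
      proof -
        have "S \<subseteq> ?N"
          using S M.in_own_span[OF \<pi>S] by auto
        moreover have "\<pi> f \<in> M.span (\<pi> ` S)" if "f \<in> I" for f
        proof -
          have "\<pi> f = \<pi> 0"
            using that IO closed(2) by (subst \<pi>_eq) auto
          then show ?thesis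
            using sp.zero_closed zero_M by simp
        qed
        ultimately show ?thesis
          using IO by auto
      qed
      ultimately have "?O \<subseteq> ?N"
        using spans fract.span_minimal by blast
      then have "carrier M \<subseteq> M.span (\<pi> ` S)"
        by (auto simp: carrier_M)
      then show "M.gen_set (\<pi> ` S)"
        using sp.subset by auto
    qed
  qed
  have lift: "\<exists>S. finite S \<and> S \<subseteq> ?O \<and> ?O \<subseteq> fract.span (S \<union> I) \<and> card S = card A"
    if A: "finite A" "A \<subseteq> carrier M" "M.gen_set A" for A
  proof -
    from A(2) obtain S where S: "S \<subseteq> ?O" "inj_on \<pi> S" "A = \<pi> ` S"
      unfolding carrier_M subset_image_inj by blast
    with A gen_set_iff show ?thesis
      by (metis card_image finite_image_iff)
  qed
  have push: "finite (\<pi> ` S) \<and> \<pi> ` S \<subseteq> carrier M \<and> M.gen_set (\<pi> ` S)"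
    if S: "finite S" "S \<subseteq> ?O" "?O \<subseteq> fract.span (S \<union> I)" for S
    using S gen_set_iff carrier_M by auto
  show ?thesis
    unfolding R_def[symmetric] I_def[symmetric] intersection_mult_def M_def[symmetric]
  proof (cases "M.fin_dim")
    case True
    then obtain A where A: "finite A" "A \<subseteq> carrier M" "M.gen_set A"
      unfolding M.fin_dim_def by blast
    let ?gen = "\<lambda>n. \<exists>A. finite A \<and> card A = n \<and> A \<subseteq> carrier M \<and> M.gen_set A"
    have "?gen (card A)"
      using A by blast
    then have "?gen M.dim"
      unfolding M.dim_def by (rule LeastI)
    then obtain A' where A': "finite A'" "card A' = M.dim" "A' \<subseteq> carrier M" "M.gen_set A'"
      by blast
    obtain S where S: "finite S" "S \<subseteq> ?O" "?O \<subseteq> fract.span (S \<union> I)" "card S = card A'"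
      using lift[OF A'(1,3,4)] by blast
    have le: "fract.quotient_dim ?O I \<le> enat M.dim"
      using fract.quotient_dim_le[OF S(1-3)] S(4) A'(2) by simp
    then obtain k where k: "fract.quotient_dim ?O I = enat k"
      by (cases "fract.quotient_dim ?O I") auto
    then obtain T where T: "finite T" "T \<subseteq> ?O" "?O \<subseteq> fract.span (T \<union> I)" "card T = k"
      by (rule fract.quotient_dim_attained)
    have "?gen (card (\<pi> ` T))"
      using push[OF T(1-3)] by blast
    then have "M.dim \<le> card (\<pi> ` T)"
      unfolding M.dim_def by (rule Least_le)
    also have "\<dots> \<le> k"
      using T card_image_le by blast
    finally show "(if M.fin_dim then enat M.dim else \<infinity>) = fract.quotient_dim ?O I"
      using True le k by simp
  next
    case False
    have "fract.quotient_dim ?O I = \<infinity>"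
    proof (cases "fract.quotient_dim ?O I")
      case (enat k)
      then obtain T where "finite T" "T \<subseteq> ?O" "?O \<subseteq> fract.span (T \<union> I)" "card T = k"
        by (rule fract.quotient_dim_attained)
      from push[OF this(1-3)] have "M.fin_dim"
        unfolding M.fin_dim_def by (rule exI)
      with False show ?thesis ..
    qed
    with False show "(if M.fin_dim then enat M.dim else \<infinity>) = fract.quotient_dim ?O I"
      by simp
  qed
qed

section \<open>Colon ideals along the Euclidean algorithm\<close>

text \<open>
  Nonzero elements of \<open>K[x]\<close> are no zero divisors modulo a \<open>y\<close>-primitive polynomial, even after
  localization: clear the denominators and apply Gauss's lemma.
\<close>
lemma const_cancel_primitive:
  assumes V: "y_primitive V" and "c \<noteq> 0"
    and "g \<in> carrier (local_ring P)" "a \<in> carrier (local_ring P)"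
    and eq: "to_fract [:c:] * g = a * to_fract V"
  shows "\<exists>e\<in>carrier (local_ring P). g = e * to_fract V"
proof -
  from assms obtain R S R' S' where g: "g = Fract R S" "eval_at S P \<noteq> 0"
    and a: "a = Fract R' S'" "eval_at S' P \<noteq> 0"
    by (auto simp: local_ring_def)
  then have nz: "S \<noteq> 0" "S' \<noteq> 0"
    by auto
  have "to_fract [:c:] * to_fract R * to_fract S' = to_fract R' * to_fract S * to_fract V"
    using eq g a nz by (simp add: Fract_conv_to_fract field_simps)
  then have "[:c:] * R * S' = R' * S * V"
    by (simp only: to_fract_eq_iff flip: to_fract_mult)
  then have "[:c:] dvd (R' * S) * V"
    by (metis dvd_triv_left mult.assoc)
  with V \<open>c \<noteq> 0\<close> have "[:c:] dvd R' * S"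
    by (rule const_dvd_primitive_mult)
  then obtain B where B: "R' * S = [:c:] * B" ..
  then have "to_fract R' * to_fract S = to_fract [:c:] * to_fract B"
    by (metis to_fract_mult)
  then have "to_fract [:c:] * to_fract B = a * to_fract (S * S')"
    using a nz by (simp add: Fract_conv_to_fract)
  then have "a = to_fract [:c:] * Fract B (S * S')"
    using nz by (simp add: Fract_conv_to_fract field_simps)
  with eq have "to_fract [:c:] * g = to_fract [:c:] * (Fract B (S * S') * to_fract V)"
    by (simp only: mult.assoc)
  then have "g = Fract B (S * S') * to_fract V"
    using \<open>c \<noteq> 0\<close> by simp
  moreover have "Fract B (S * S') \<in> carrier (local_ring P)"
    using g a unfolding local_ring_def by fastforce
  ultimately show ?thesis
    by blast
qed

definition colon :: "'a::field \<times> 'a \<Rightarrow> 'a poly \<Rightarrow> 'a poly poly \<Rightarrow> 'a poly poly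
    \<Rightarrow> 'a poly poly fract set" where
  "colon P w V W =
    {f \<in> carrier (local_ring P). to_fract [:w:] * f \<in> intersection_ideal P V W}"

lemma colonI:
  assumes "f \<in> carrier (local_ring P)" "a \<in> carrier (local_ring P)" "b \<in> carrier (local_ring P)"
    "to_fract [:w:] * f = a * to_fract V + b * to_fract W"
  shows "f \<in> colon P w V W"
  using assms by (auto simp: colon_def mem_intersection_ideal_iff)

lemma colonE:
  assumes "f \<in> colon P w V W"
  obtains a b where "f \<in> carrier (local_ring P)" "a \<in> carrier (local_ring P)"
    "b \<in> carrier (local_ring P)" "to_fract [:w:] * f = a * to_fract V + b * to_fract W"
  using assms by (auto simp: colon_def mem_intersection_ideal_iff)

lemma subspace_colon: "fract.subspace (colon P w V W)"
proof (rule fract.subspaceI)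
  show "0 \<in> colon P w V W"
    by (rule colonI[of _ _ 0 0]) auto
  show "x + y \<in> colon P w V W" if "x \<in> colon P w V W" "y \<in> colon P w V W" for x y
    using that fract.subspace_add[OF subspace_intersection_ideal, of _ P V W]
    by (simp add: colon_def distrib_left local_ring_closed)
  show "const_scale c x \<in> colon P w V W" if "x \<in> colon P w V W" for c x
    using that fract.subspace_scale[OF subspace_intersection_ideal, of "to_fract [:w:] * x" P V W c]
    by (simp add: colon_def const_scale_def mult.left_commute local_ring_closed)
qed

lemma colon_one: "colon P 1 V W = intersection_ideal P V W"
  using intersection_ideal_subset[of P V W] by (auto simp: colon_def simp flip: one_pCons)

text \<open>
  In terms of ideals, \<open>(V1, V2) : w = (V2, u V1) : u w = (V2, v V3) : u w\<close>, and the common factor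
  \<open>d\<close> of \<open>v\<close> and \<open>u w\<close> may be dropped from both. Inserting \<open>u\<close> and dropping \<open>d\<close> are legitimate
  because neither is a zero divisor modulo \<open>V2\<close>.
\<close>
lemma colon_euclid_step:
  fixes V1 V2 V3 :: "'a::field poly poly"
  assumes V2: "y_primitive V2"
    and nz: "u \<noteq> 0" "d \<noteq> 0"
    and rel: "[:u:] * V1 = Q * V2 + [:v:] * V3"
    and d: "w * u = d * w'" "v = d * v'"
  shows "colon P w V1 V2 = colon P w' V2 ([:v':] * V3)"
proof -
  let ?O = "carrier (local_ring P)"
  let ?k = "\<lambda>c. to_fract [:c:] :: 'a poly poly fract"
  have k_mult: "?k (a * b) = ?k a * ?k b" for a b
    by (simp flip: to_fract_mult)
  have R: "?k u * to_fract V1 = to_fract Q * to_fract V2 + ?k d * ?k v' * to_fract V3"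
    using arg_cong[OF rel, of to_fract] unfolding d k_mult to_fract_add to_fract_mult .
  have W: "?k d * (?k w' * f) = ?k u * (?k w * f)" for f
  proof -
    have "?k u * ?k w = ?k d * ?k w'"
      using d(1) by (metis k_mult mult.commute)
    then show ?thesis
      by (simp only: flip: mult.assoc)
  qed
  show ?thesis
  proof (intro subset_antisym subsetI)
    fix f assume "f \<in> colon P w V1 V2"
    then obtain a b where f: "f \<in> ?O" "a \<in> ?O" "b \<in> ?O"
      "?k w * f = a * to_fract V1 + b * to_fract V2"
      by (rule colonE)
    have "?k d * (?k w' * f - a * (?k v' * to_fract V3)) =
        ?k u * (?k w * f) - a * (?k d * ?k v' * to_fract V3)"
      unfolding right_diff_distrib W by (simp only: ac_simps)
    also have "\<dots> = a * (?k u * to_fract V1 - ?k d * ?k v' * to_fract V3) + ?k u * b * to_fract V2"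
      using f(4) by (simp add: algebra_simps)
    also have "\<dots> = (a * to_fract Q + ?k u * b) * to_fract V2"
      unfolding R by (simp add: algebra_simps)
    finally obtain e where e: "e \<in> ?O" "?k w' * f - a * (?k v' * to_fract V3) = e * to_fract V2"
      using const_cancel_primitive[OF V2 nz(2), of "?k w' * f - a * (?k v' * to_fract V3)" P] f
      by (metis local_ring_closed)
    then have "?k w' * f = e * to_fract V2 + a * to_fract ([:v':] * V3)"
      by (simp only: diff_eq_eq to_fract_mult)
    then show "f \<in> colon P w' V2 ([:v':] * V3)"
      using f e by (intro colonI[of _ _ e a])
  next
    fix f assume "f \<in> colon P w' V2 ([:v':] * V3)"
    then obtain a b where f: "f \<in> ?O" "a \<in> ?O" "b \<in> ?O"
      "?k w' * f = a * to_fract V2 + b * to_fract ([:v':] * V3)"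
      by (rule colonE)
    have "?k u * (?k w * f - b * to_fract V1) = ?k d * (?k w' * f) - b * (?k u * to_fract V1)"
      unfolding right_diff_distrib W by (simp only: ac_simps)
    also have "\<dots> = (?k d * a - b * to_fract Q) * to_fract V2"
      unfolding f(4) R to_fract_mult by (simp add: algebra_simps)
    finally obtain e where e: "e \<in> ?O" "?k w * f - b * to_fract V1 = e * to_fract V2"
      using const_cancel_primitive[OF V2 nz(1), of "?k w * f - b * to_fract V1" P] f
      by (metis local_ring_closed)
    then show "f \<in> colon P w V1 V2"
      using f by (intro colonI[of _ _ b e]) (simp_all add: algebra_simps)
  qed
qed

text \<open>
  Write \<open>O\<close> for the local ring. Multiplication by \<open>v\<close> gives the exact sequence
  \<open>0 \<rightarrow> O/((V, W) : w) \<rightarrow> O/((V, v W) : w) \<rightarrow> O/(V, v) \<rightarrow> 0\<close>. It is injective since \<open>v\<close> is no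
  zero divisor modulo \<open>V\<close>. Its cokernel is \<open>O\<close> modulo \<open>(v) + ((V, v W) : w)\<close>, and this sum is
  \<open>(V, v)\<close>: if \<open>w f \<in> (V, v)\<close>, then \<open>f \<in> (V, v)\<close>, because \<open>w\<close> is invertible modulo \<open>v\<close>.
\<close>
lemma quotient_dim_colon_times_const:
  fixes V W :: "'a::field poly poly"
  assumes V: "y_primitive V" and "v \<noteq> 0" and bezout: "1 = r * w + s * v"
  shows "fract.quotient_dim (carrier (local_ring P)) (colon P w V ([:v:] * W)) =
    intersection_mult P V [:v:] + fract.quotient_dim (carrier (local_ring P)) (colon P w V W)"
proof -
  let ?O = "carrier (local_ring P)"
  let ?k = "\<lambda>c. to_fract [:c:] :: 'a poly poly fract"
  let ?L = "colon P w V ([:v:] * W)" and ?A = "intersection_ideal P V [:v:]"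
  have k1: "1 = ?k r * ?k w + ?k s * ?k v"
  proof -
    have "[:1:] = [:r:] * [:w:] + [:s:] * [:v:]"
      using bezout by (simp add: mult.commute)
    from arg_cong[OF this, of to_fract] show ?thesis
      by (simp only: to_fract_add to_fract_mult to_fract_1 flip: one_pCons)
  qed
  have LA: "?L \<subseteq> ?A"
  proof
    fix f assume "f \<in> ?L"
    then obtain a b where f: "f \<in> ?O" "a \<in> ?O" "b \<in> ?O"
      "?k w * f = a * to_fract V + b * to_fract ([:v:] * W)"
      by (rule colonE)
    have "f = ?k r * (?k w * f) + ?k s * ?k v * f"
      using arg_cong[OF k1, of "\<lambda>z. z * f"] by (simp only: algebra_simps mult_1)
    also have "\<dots> = (?k r * a) * to_fract V + (?k r * b * to_fract W + ?k s * f) * ?k v"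
      unfolding f(4) to_fract_mult by (simp only: algebra_simps)
    finally show "f \<in> ?A"
      using f unfolding mem_intersection_ideal_iff by (blast intro: local_ring_closed)
  qed
  have "fract.quotient_dim ?A ?L = fract.quotient_dim ?O {f \<in> ?O. ?k v * f \<in> ?L}"
  proof (rule fract.quotient_dim_transport)
    show "module_hom const_scale const_scale ((*) (?k v))"
      by unfold_locales (simp_all add: const_scale_def algebra_simps)
    show "(*) (?k v) ` ?O \<subseteq> ?A"
    proof (intro image_subsetI)
      fix f assume "f \<in> ?O"
      then show "?k v * f \<in> ?A"
        unfolding mem_intersection_ideal_iff by (intro bexI[of _ 0] bexI[of _ f]) auto
    qed
    show "?A \<subseteq> fract.span ((*) (?k v) ` ?O \<union> ?L)"
    proof
      fix f assume "f \<in> ?A"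
      then obtain a b where f: "a \<in> ?O" "b \<in> ?O" "f = a * to_fract V + b * ?k v"
        by (auto simp: mem_intersection_ideal_iff)
      have "a * to_fract V \<in> ?L"
        using f by (intro colonI[of _ _ "?k w * a" 0]) auto
      moreover have "b * ?k v \<in> (*) (?k v) ` ?O"
        using f by (auto simp: mult.commute)
      ultimately show "f \<in> fract.span ((*) (?k v) ` ?O \<union> ?L)"
        unfolding f(3) by (intro fract.span_add fract.span_base) auto
    qed
  qed (rule subspace_colon subspace_local_ring)+
  also have "{f \<in> ?O. ?k v * f \<in> ?L} = colon P w V W"
  proof (intro subset_antisym subsetI)
    fix f assume "f \<in> {f \<in> ?O. ?k v * f \<in> ?L}"
    then obtain a b where f: "f \<in> ?O" "a \<in> ?O" "b \<in> ?O"
      "?k w * (?k v * f) = a * to_fract V + b * to_fract ([:v:] * W)"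
      by (auto elim: colonE)
    then have "?k v * (?k w * f - b * to_fract W) = a * to_fract V"
      by (simp only: to_fract_mult algebra_simps)
    then obtain e where "e \<in> ?O" "?k w * f - b * to_fract W = e * to_fract V"
      using const_cancel_primitive[OF V \<open>v \<noteq> 0\<close>, of "?k w * f - b * to_fract W" P a] f
      by blast
    then show "f \<in> colon P w V W"
      using f by (intro colonI[of _ _ e b]) (simp_all add: algebra_simps)
  next
    fix f assume "f \<in> colon P w V W"
    then obtain a b where f: "f \<in> ?O" "a \<in> ?O" "b \<in> ?O"
      "?k w * f = a * to_fract V + b * to_fract W"
      by (rule colonE)
    have "?k w * (?k v * f) = ?k v * (?k w * f)"
      by (simp only: mult.left_commute)
    also have "\<dots> = (?k v * a) * to_fract V + b * to_fract ([:v:] * W)"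
      unfolding f(4) to_fract_mult by (simp only: algebra_simps)
    finally have "?k v * f \<in> ?L"
      using f by (intro colonI[of _ _ "?k v * a" b]) auto
    with f show "f \<in> {f \<in> ?O. ?k v * f \<in> ?L}"
      by simp
  qed
  finally have kernel: "fract.quotient_dim ?A ?L = fract.quotient_dim ?O (colon P w V W)" .
  have "fract.quotient_dim ?O ?L = fract.quotient_dim ?O ?A + fract.quotient_dim ?A ?L"
    by (rule fract.quotient_dim_add[OF subspace_intersection_ideal LA intersection_ideal_subset])
  then show ?thesis
    by (simp only: kernel intersection_mult_eq_quotient_dim)
qed

text \<open>
  One division step splits off one summand of the intersection multiplicity and passes from the
  weight \<open>w\<close> to the weight \<open>w u / d\<close>, which is coprime to \<open>v / d\<close>.
\<close>
lemma quotient_dim_euclid_step: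
  fixes V1 V2 V3 :: "'a::field poly poly"
  assumes V2: "y_primitive V2" and nz: "u \<noteq> 0" "v \<noteq> 0"
    and rel: "[:u:] * V1 = Q * V2 + [:v:] * V3"
    and d: "is_gcd {w * u, v} d"
  shows "fract.quotient_dim (carrier (local_ring P)) (colon P w V1 V2) =
    intersection_mult P V2 [:v div d:] +
    fract.quotient_dim (carrier (local_ring P)) (colon P (w * u div d) V2 V3)"
proof -
  have "\<forall>a\<in>{w * u, v}. d dvd a"
    using d unfolding is_gcd_def by (rule conjunct1)
  then have dvd: "d dvd w * u" "d dvd v"
    by simp_all
  with nz have "d \<noteq> 0"
    by (metis dvd_0_left)
  define x y where "x = w * u div d" and "y = v div d"
  have eqs: "w * u = d * x" "v = d * y"
    unfolding x_def y_def by (rule dvd_mult_div_cancel[symmetric], fact dvd)+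
  obtain r s where "d = r * (w * u) + s * v"
    using is_gcd_imp_bezout[OF d] by blast
  also have "\<dots> = d * (r * x + s * y)"
    unfolding eqs by (simp only: algebra_simps)
  finally have bezout: "1 = r * x + s * y"
    using \<open>d \<noteq> 0\<close> by (metis mult_1_right mult_cancel_left)
  have "y \<noteq> 0"
    using eqs nz by auto
  then show ?thesis
    using colon_euclid_step[OF V2 nz(1) \<open>d \<noteq> 0\<close> rel eqs] quotient_dim_colon_times_const[OF V2 _ bezout]
    by (simp add: x_def y_def)
qed

theorem theorem2p2:
  fixes V Q :: "nat \<Rightarrow> 'a::field poly poly"
    and u v d w :: "nat \<Rightarrow> 'a poly"
    and n :: nat
    and P :: "'a \<times> 'a"
  assumes "n \<ge> 1"
    and "coprime (V 1) (V 2)"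
    and "\<And>i. i \<in> {1..n+1} \<Longrightarrow> y_primitive (V i)"
    and "0 < degree (V 2)" and "degree (V 2) \<le> degree (V 1)"
    and "\<And>i. i \<in> {2..n} \<Longrightarrow> degree (V (i+1)) < degree (V i)"
    and "0 < degree (V (n+1))"
    and "V (n+2) = 1"
    and "\<And>i. i \<in> {1..n} \<Longrightarrow> u i \<noteq> 0 \<and> v i \<noteq> 0"
    and "\<And>i. i \<in> {1..n} \<Longrightarrow>
           [:u i:] * V i = Q i * V (i+1) + [:v i:] * V (i+2)"
    and "is_gcd {u 1, v 1} (d 1)" and "w 1 = u 1 div d 1"
    and "\<And>i. i \<in> {2..n} \<Longrightarrow> is_gcd {w (i-1) * u i, v i} (d i)"
    and "\<And>i. i \<in> {2..n} \<Longrightarrow> w i = (w (i-1) * u i) div d i"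
  shows "intersection_mult P (V 1) (V 2)
           = (\<Sum>i=1..n. intersection_mult P (V (i+1)) [:v i div d i:])"
proof -
  note prim = assms(3) and last = assms(8) and nz = assms(9) and rel = assms(10)
  let ?O = "carrier (local_ring P)"
  \<comment> \<open>With \<open>w' 0 = 1\<close> the first step obeys the same recursion as the later ones.\<close>
  define w' where "w' i = (if i = 0 then 1 else w i)" for i
  have gcd: "is_gcd {w' (i - 1) * u i, v i} (d i)" and w': "w' i = w' (i - 1) * u i div d i"
    if "i \<in> {1..n}" for i
  proof -
    have "is_gcd {w' (i - 1) * u i, v i} (d i) \<and> w' i = w' (i - 1) * u i div d i"
    proof (cases "i = 1")
      case True
      with assms(11,12) show ?thesis
        by (simp add: w'_def)
    next
      case False
      with that have "i \<in> {2..n}" and nz: "i \<noteq> 0" "i - 1 \<noteq> 0"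
        by auto
      with assms(13,14)[of i] show ?thesis
        by (simp only: w'_def if_False simp_thms)
    qed
    then show "is_gcd {w' (i - 1) * u i, v i} (d i)" "w' i = w' (i - 1) * u i div d i"
      by blast+
  qed
  have step: "fract.quotient_dim ?O (colon P (w' k) (V (k + 1)) (V (k + 2))) =
      intersection_mult P (V (k + 2)) [:v (k + 1) div d (k + 1):] +
      fract.quotient_dim ?O (colon P (w' (k + 1)) (V (k + 2)) (V (k + 3)))" if "k < n" for k
    using quotient_dim_euclid_step[of "V (k + 2)" "u (k + 1)" "v (k + 1)" "V (k + 1)" "Q (k + 1)"
        "V (k + 3)" "w' k" "d (k + 1)" P]
      prim[of "k + 2"] nz[of "k + 1"] rel[of "k + 1"] gcd[of "k + 1"] w'[of "k + 1"] that
    by (simp add: eval_nat_numeral)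
  have partial: "intersection_mult P (V 1) (V 2) =
      (\<Sum>i=1..k. intersection_mult P (V (i+1)) [:v i div d i:]) +
      fract.quotient_dim ?O (colon P (w' k) (V (k + 1)) (V (k + 2)))" if "k \<le> n" for k
    using that
  proof (induction k)
    case 0
    show ?case
      by (simp add: intersection_mult_eq_quotient_dim w'_def colon_one numeral_2_eq_2)
  next
    case (Suc k)
    then show ?case
      using step[of k] by (simp add: add.assoc eval_nat_numeral)
  qed
  have "colon P (w' n) (V (n + 1)) (V (n + 2)) = ?O"
  proof -
    have "f \<in> colon P (w' n) (V (n + 1)) (V (n + 2))" if "f \<in> ?O" for f
      using that last by (intro colonI[of _ _ 0 "to_fract [:w' n:] * f"]) auto
    then show ?thesis
      by (auto simp: colon_def)
  qed
  then show ?thesis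
    using partial[OF order_refl] by (simp only: fract.quotient_dim_self add_0_right)
qed

end
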